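(* Let $\mathbf{S}:\Delta\to\mathbb{R}^3$ be a strictly proper scoring rule over three outcomes $\{X,Y,Z\}$ satisfying the technical assumptions (continuity, differentiability, quasiconcavity), and let $\overline{\mathbf{q}}$ be any point of the interior of $\Delta$. Then there are a nonempty $2$-dimensional open set $N\subset\Delta$ of beliefs, a budget $b>0$, and a report $\mathbf{r}\in\Delta$ that is feasible, i.e. $\mathrm{nb}(\overline{\mathbf{q}},\mathbf{r})\le b$, such that for every belief $\mathbf{p}\in N$ the optimal budget-constrained report $\mathbf{q}^*(\mathbf{p},\overline{\mathbf{q}},b)$ is $\mathbf{r}$.
   Context: $\Delta$ is the $2$-dimensional simplex of probability vectors $\mathbf{p}=(p_X,p_Y,p_Z)$; interior and open sets are relative to the plane $p_X+p_Y+p_Z=1$. A scoring rule is a map $\mathbf{S}=(S_X,S_Y,S_Z):\Delta\to\mathbb{R}^3$; an agent with belief $\mathbf{p}$ reporting $\mathbf{q}$ has expected score $\mathbf{p}\cdot\mathbf{S}(\mathbf{q})$. It is strictly proper if for every $\mathbf{p}\in\Delta$, $\mathbf{q}=\mathbf{p}$ is the unique maximizer of $\mathbf{p}\cdot\mathbf{S}(\mathbf{q})$. Technical assumptions: $\mathbf{S}$ is continuous and differentiable on the interior of $\Delta$; and for each outcome $\omega\in\{X,Y,Z\}$ and all $\mathbf{p},\mathbf{q}\in\Delta$, $S_\omega(0.5\mathbf{p}+0.5\mathbf{q})\ge\min(S_\omega(\mathbf{p}),S_\omega(\mathbf{q}))$, with equality only if $S_\omega(\mathbf{p})=S_\omega(\mathbf{q})$.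 Natural budget: $\mathrm{nb}(\overline{\mathbf{q}},\mathbf{q})=\max_{\omega\in\{X,Y,Z\}}[S_\omega(\overline{\mathbf{q}})-S_\omega(\mathbf{q})]$. The optimal budget-constrained report $\mathbf{q}^*(\mathbf{p},\overline{\mathbf{q}},b)$ is the maximizer of $\mathbf{p}\cdot\mathbf{S}(\mathbf{q})$ among all $\mathbf{q}\in\Delta$ with $\mathrm{nb}(\overline{\mathbf{q}},\mathbf{q})\le b$. *)

theory Defs
  imports "HOL-Analysis.Analysis"
begin

text \<open>The three outcomes X, Y, Z are the elements of the three-element index type.\<close>

type_synonym outcome = 3

type_synonym belief = "real ^ outcome"

definition belief_plane :: "belief set" where
  "belief_plane = {p. (\<Sum>\<omega>\<in>UNIV. p $ \<omega>) = 1}"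

definition belief_simplex :: "belief set" where
  "belief_simplex = {p. (\<forall>\<omega>. 0 \<le> p $ \<omega>) \<and> (\<Sum>\<omega>\<in>UNIV. p $ \<omega>) = 1}"

definition simplex_interior :: "belief set" where
  "simplex_interior = top_of_set belief_plane interior_of belief_simplex"

text \<open>
  A scoring rule is a total function on the ambient space; every notion below
  uses only its values on the simplex.
\<close>

type_synonym scoring_rule = "belief \<Rightarrow> real ^ outcome"

definition expected_score :: "scoring_rule \<Rightarrow> belief \<Rightarrow> belief \<Rightarrow> real" where
  "expected_score S p q = p \<bullet> S q"

definition maximizers :: "('a \<Rightarrow> real) \<Rightarrow> 'a set \<Rightarrow> 'a set" where
  "maximizers f A = {x. is_arg_max f (\<lambda>y. y \<in> A) x}"

definition strictly_proper :: "scoring_rule \<Rightarrow> bool" where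
  "strictly_proper S \<longleftrightarrow> (\<forall>p\<in>belief_simplex. maximizers (expected_score S p) belief_simplex = {p})"

definition midpoint_quasiconcave :: "scoring_rule \<Rightarrow> bool" where
  "midpoint_quasiconcave S \<longleftrightarrow>
     (\<forall>\<omega>. \<forall>p\<in>belief_simplex. \<forall>q\<in>belief_simplex.
        S ((1/2) *\<^sub>R p + (1/2) *\<^sub>R q) $ \<omega> \<ge> min (S p $ \<omega>) (S q $ \<omega>) \<and>
        (S ((1/2) *\<^sub>R p + (1/2) *\<^sub>R q) $ \<omega> = min (S p $ \<omega>) (S q $ \<omega>)
           \<longrightarrow> S p $ \<omega> = S q $ \<omega>))"

text \<open>
  Differentiability is taken within the interior, which is open in the plane, so it is
  differentiability along the plane and says nothing about values of \<open>S\<close> off the plane.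
  Continuity is required on the interior only, not at the boundary of the simplex.
\<close>

definition technical_assumptions :: "scoring_rule \<Rightarrow> bool" where
  "technical_assumptions S \<longleftrightarrow>
     continuous_on simplex_interior S \<and>
     S differentiable_on simplex_interior \<and>
     midpoint_quasiconcave S"

definition natural_budget :: "scoring_rule \<Rightarrow> belief \<Rightarrow> belief \<Rightarrow> real" where
  "natural_budget S qbar q = Max (range (\<lambda>\<omega>. S qbar $ \<omega> - S q $ \<omega>))"

definition feasible_reports :: "scoring_rule \<Rightarrow> belief \<Rightarrow> real \<Rightarrow> belief set" where
  "feasible_reports S qbar b = {q \<in> belief_simplex. natural_budget S qbar q \<le> b}"

text \<open>
  That the optimal report exists and equals \<open>r\<close> is expressed as
  \<open>optimal_reports S p qbar b = {r}\<close>.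
\<close>

definition optimal_reports :: "scoring_rule \<Rightarrow> belief \<Rightarrow> belief \<Rightarrow> real \<Rightarrow> belief set" where
  "optimal_reports S p qbar b = maximizers (expected_score S p) (feasible_reports S qbar b)"

end

theory Submission
  imports Defs
begin

text \<open>
  Suppose \<open>r\<close> is interior and two of the three coordinates of
  \<open>S qbar - S r\<close> equal their maximum \<open>b\<close>; let \<open>k\<close> be the remaining
  outcome. If \<open>p\<close> lies beyond \<open>r\<close> in the direction of \<open>k\<close>, then
  \<open>p\<close> is a positive multiple of \<open>r\<close> minus a nonnegative combination of the other
  two unit vectors. Feasibility bounds the scores in those two outcomes from below by those of
  \<open>r\<close>, and properness bounds \<open>r \<bullet> S q\<close> by \<open>r \<bullet> S r\<close>, so
  \<open>r\<close> is optimal for \<open>p\<close>.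

  Such an \<open>r\<close> exists by connectedness. Moving from \<open>qbar\<close> towards the vertex
  \<open>k\<close> raises \<open>S\<^sub>k\<close>, so at \<open>v k\<close>, the midpoint of \<open>qbar\<close> and that vertex,
  the largest loss is in some outcome \<open>i \<noteq> k\<close>, while at \<open>v i\<close> it is in an outcome
  other than \<open>i\<close>. Hence there is a tie on the segment from \<open>v k\<close> to
  \<open>v i\<close>, which misses \<open>qbar\<close>.
\<close>

section \<open>Ties between maximal coordinates on a connected set\<close>

lemma connected_maximal_coordinate_tie:
  fixes f :: "'a::topological_space \<Rightarrow> real ^ 'n"
  assumes T: "connected T" and f: "continuous_on T f"
    and a: "a \<in> T" "\<And>l. f a $ l \<le> f a $ i"
    and b: "b \<in> T" "\<And>l. f b $ l \<le> f b $ j" and "i \<noteq> j"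
  obtains x m n where "x \<in> T" "m \<noteq> n" "\<And>l. f x $ l \<le> f x $ m" "\<And>l. f x $ l \<le> f x $ n"
proof (rule ccontr)
  assume "\<not> thesis"
  then have no_tie: "m = n" if "x \<in> T" "\<forall>l. f x $ l \<le> f x $ m" "\<forall>l. f x $ l \<le> f x $ n" for x m n
    using that \<open>\<And>x m n. \<lbrakk>x \<in> T; m \<noteq> n; \<And>l. f x $ l \<le> f x $ m; \<And>l. f x $ l \<le> f x $ n\<rbrakk> \<Longrightarrow> thesis\<close>
    by blast
  \<comment> \<open>The sets \<open>A m\<close> are closed in \<open>T\<close> and cover it, since
    there are only finitely many coordinates. Without a tie they are pairwise disjoint, so the
    complement of \<open>A i\<close> is a finite union of closed sets and \<open>A i\<close> is
    clopen.\<close>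
  define A where "A m = T \<inter> f -` {y. \<forall>l. y $ l \<le> y $ m}" for m
  have closed: "closedin (top_of_set T) (A m)" for m
    unfolding A_def
    by (intro continuous_closedin_preimage f closed_Collect_all closed_Collect_le continuous_intros)
  have "\<exists>m. \<forall>l. f x $ l \<le> f x $ m" for x
  proof -
    have "Max (range (($) (f x))) \<in> range (($) (f x))"
      by (intro Max_in) auto
    then obtain m where m: "f x $ m = Max (range (($) (f x)))"
      by (metis rangeE)
    have "f x $ l \<le> f x $ m" for l
      unfolding m by (rule Max_ge) auto
    then show ?thesis by blast
  qed
  then have "T - A i = (\<Union>m\<in>-{i}. A m)"
    using no_tie by (fastforce simp: A_def)
  moreover have "closedin (top_of_set T) (\<Union>m\<in>-{i}. A m)"
    by (intro closedin_Union) (auto intro: closed)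
  ultimately have "openin (top_of_set T) (A i)"
    by (simp add: openin_closedin_eq A_def)
  then have "A i = {} \<or> A i = T"
    using closed T connected_clopen by blast
  moreover have "a \<in> A i"
    using a by (simp add: A_def)
  ultimately have "b \<in> A i"
    using b by auto
  then have "i = j"
    using b by (intro no_tie[of b]) (auto simp: A_def)
  with \<open>i \<noteq> j\<close> show False
    by simp
qed

section \<open>The relative interior of the simplex\<close>

lemma open_Collect_all_finite:
  fixes P :: "'i::finite \<Rightarrow> 'a::topological_space \<Rightarrow> bool"
  assumes "\<And>i. open {x. P i x}"
  shows "open {x. \<forall>i. P i x}"
proof -
  have "open (\<Inter>i. {x. P i x})"
    using assms by (intro open_INT) auto
  moreover have "(\<Inter>i. {x. P i x}) = {x. \<forall>i. P i x}"
    by auto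
  ultimately show ?thesis
    by simp
qed

text \<open>Coordinate description of \<open>simplex_interior\<close>, established in
  \<open>simplex_interior_eq\<close>; openness and convexity are easier to obtain in this
  form.\<close>

definition positive_beliefs :: "belief set" where
  "positive_beliefs = {p \<in> belief_plane. \<forall>\<omega>. 0 < p $ \<omega>}"

lemma positive_beliefs_subset_simplex: "positive_beliefs \<subseteq> belief_simplex"
  by (auto simp: positive_beliefs_def belief_plane_def belief_simplex_def less_imp_le)

lemma openin_positive_beliefs: "openin (top_of_set belief_plane) positive_beliefs"
proof -
  have "open {p :: belief. \<forall>\<omega>. 0 < p $ \<omega>}"
    by (intro open_Collect_all_finite open_Collect_less continuous_intros)
  moreover have "positive_beliefs = belief_plane \<inter> {p. \<forall>\<omega>. 0 < p $ \<omega>}"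
    by (auto simp: positive_beliefs_def)
  ultimately show ?thesis
    by (metis openin_open_Int)
qed

lemma simplex_interior_eq: "simplex_interior = positive_beliefs"
proof
  show "positive_beliefs \<subseteq> simplex_interior"
    unfolding simplex_interior_def
    by (intro interior_of_maximal positive_beliefs_subset_simplex openin_positive_beliefs)
next
  show "simplex_interior \<subseteq> positive_beliefs"
  proof
    fix p assume "p \<in> simplex_interior"
    then obtain U where U: "openin (top_of_set belief_plane) U" "p \<in> U" "U \<subseteq> belief_simplex"
      by (auto simp: simplex_interior_def interior_of_def)
    then obtain e where e: "e > 0" "ball p e \<inter> belief_plane \<subseteq> U"
      by (meson openin_contains_ball)
    have p: "(\<Sum>\<omega>\<in>UNIV. p $ \<omega>) = 1" "\<And>\<omega>. 0 \<le> p $ \<omega>"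
      using U by (auto simp: belief_simplex_def)
    have "0 < p $ \<omega>" for \<omega>
    proof (rule ccontr)
      assume "\<not> 0 < p $ \<omega>"
      then have zero: "p $ \<omega> = 0"
        using p(2)[of \<omega>] by simp
      \<comment> \<open>Moving from \<open>p\<close> away from the vertex \<open>\<omega>\<close>
        stays in the plane, as the coordinates of \<open>d\<close> sum to 0, but changes the zero
        coordinate to \<open>-t\<close>. The summand 1 in the denominator of \<open>t\<close> keeps
        it positive, and the step has length at most \<open>e / 2\<close>.\<close>
      define d where "d = p - axis \<omega> 1"
      define t where "t = e / (2 * (norm d + 1))"
      have t: "t > 0"
        using e by (simp add: t_def add_nonneg_pos)
      have "norm (t *\<^sub>R d) < e"
      proof -
        have "t * norm d \<le> t * (norm d + 1)" using t by simp
        also have "\<dots> = e / 2"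
        proof -
          have "norm d + 1 \<noteq> 0" by (smt (verit) norm_ge_zero)
          then show ?thesis by (simp add: t_def field_simps)
        qed
        finally show ?thesis using e t by simp
      qed
      then have "p + t *\<^sub>R d \<in> ball p e"
        by (simp add: dist_norm)
      moreover have "p + t *\<^sub>R d \<in> belief_plane"
        using p by (simp add: belief_plane_def d_def sum.distrib sum_subtractf axis_def
            flip: sum_distrib_left)
      ultimately have "p + t *\<^sub>R d \<in> belief_simplex"
        using e U by blast
      then have "0 \<le> (p + t *\<^sub>R d) $ \<omega>"
        by (simp add: belief_simplex_def)
      then show False
        using zero t by (simp add: d_def axis_def)
    qed
    then show "p \<in> positive_beliefs"
      using p by (simp add: positive_beliefs_def belief_plane_def)
  qed
qed

lemma convex_positive_beliefs: "convex positive_beliefs"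
proof (rule convexI)
  fix x y :: belief and u v :: real
  assume x: "x \<in> positive_beliefs" and y: "y \<in> positive_beliefs"
    and uv: "0 \<le> u" "0 \<le> v" "u + v = 1"
  have "0 < u * x $ \<omega> + v * y $ \<omega>" for \<omega>
  proof (cases "u = 0")
    case True
    then show ?thesis using uv y by (simp add: positive_beliefs_def)
  next
    case False
    then show ?thesis
      using uv x y by (intro add_pos_nonneg) (auto simp: positive_beliefs_def less_imp_le)
  qed
  then show "u *\<^sub>R x + v *\<^sub>R y \<in> positive_beliefs"
    using x y uv
    by (simp add: positive_beliefs_def belief_plane_def sum.distrib flip: sum_distrib_left)
qed

lemma midpoint_vertex_in_positive_beliefs:
  assumes "p \<in> positive_beliefs"
  shows "(1/2) *\<^sub>R p + (1/2) *\<^sub>R axis \<omega> 1 \<in> positive_beliefs"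
proof -
  have "0 < p $ l / 2 + (if l = \<omega> then 1 else 0) / 2" for l
    using assms by (simp add: positive_beliefs_def add_pos_pos)
  then show ?thesis
    using assms
    by (simp add: positive_beliefs_def belief_plane_def sum.distrib axis_def add_divide_distrib
        flip: sum_divide_distrib)
qed

section \<open>Strict properness and the natural budget\<close>

lemma strictly_proper_less:
  assumes "strictly_proper S" "p \<in> belief_simplex" "q \<in> belief_simplex" "q \<noteq> p"
  shows "p \<bullet> S q < p \<bullet> S p"
proof -
  have max: "maximizers (expected_score S p) belief_simplex = {p}"
    using assms by (simp add: strictly_proper_def)
  have p: "p \<bullet> S x \<le> p \<bullet> S p" if "x \<in> belief_simplex" for x
  proof -
    have "p \<in> maximizers (expected_score S p) belief_simplex"
      using max by simp
    then show ?thesis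
      using that by (auto simp: maximizers_def is_arg_max_def expected_score_def not_less)
  qed
  have "q \<notin> maximizers (expected_score S p) belief_simplex"
    using max assms by simp
  then obtain x where "x \<in> belief_simplex" "p \<bullet> S q < p \<bullet> S x"
    using assms by (auto simp: maximizers_def is_arg_max_def expected_score_def)
  with p show ?thesis
    by fastforce
qed

text \<open>The gain \<open>S v - S q\<close> is positive on average under \<open>v\<close> and
  negative under \<open>q\<close>. Since \<open>v\<close> is the mean of \<open>q\<close> and the
  vertex, the gain at the vertex must be positive.\<close>

lemma score_increases_towards_vertex:
  assumes S: "strictly_proper S" and q: "q \<in> positive_beliefs"
    and v: "v = (1/2) *\<^sub>R q + (1/2) *\<^sub>R axis \<omega> 1" and "v \<noteq> q"
  shows "S q $ \<omega> < S v $ \<omega>"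
proof -
  have mem: "q \<in> belief_simplex" "v \<in> belief_simplex"
    using q midpoint_vertex_in_positive_beliefs[OF q] positive_beliefs_subset_simplex v by auto
  have "q \<bullet> S v < q \<bullet> S q" "v \<bullet> S q < v \<bullet> S v"
    using strictly_proper_less[OF S] mem \<open>v \<noteq> q\<close> by auto
  then show ?thesis
    by (simp add: v inner_add_left inner_axis')
qed

lemma natural_budget_ge: "S qbar $ \<omega> - S q $ \<omega> \<le> natural_budget S qbar q"
  unfolding natural_budget_def by (rule Max_ge) auto

lemma natural_budget_attained:
  obtains \<omega> where "natural_budget S qbar q = S qbar $ \<omega> - S q $ \<omega>"
proof -
  have "natural_budget S qbar q \<in> range (\<lambda>\<omega>. S qbar $ \<omega> - S q $ \<omega>)"
    unfolding natural_budget_def by (intro Max_in) auto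
  then show ?thesis
    using that by auto
qed

text \<open>If no outcome lost score, reporting \<open>q\<close> would do at least as well as
  \<open>qbar\<close> under the belief \<open>qbar\<close>.\<close>

lemma natural_budget_pos:
  assumes "strictly_proper S" "qbar \<in> belief_simplex" "q \<in> belief_simplex" "q \<noteq> qbar"
  shows "0 < natural_budget S qbar q"
proof (rule ccontr)
  assume "\<not> 0 < natural_budget S qbar q"
  then have "S qbar $ \<omega> \<le> S q $ \<omega>" for \<omega>
    using natural_budget_ge[of S qbar \<omega> q] by linarith
  then have "qbar \<bullet> S qbar \<le> qbar \<bullet> S q"
    using assms by (auto simp: inner_vec_def belief_simplex_def intro!: sum_mono mult_left_mono)
  with strictly_proper_less[OF assms] show False
    by simp
qed

section \<open>A report at which two outcomes share the largest loss\<close>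

lemma exists_tie:
  assumes S: "strictly_proper S" and cont: "continuous_on positive_beliefs S"
    and qbar: "qbar \<in> positive_beliefs"
  obtains r i j where "r \<in> positive_beliefs" "r \<noteq> qbar" "i \<noteq> j"
    "S qbar $ i - S r $ i = natural_budget S qbar r"
    "S qbar $ j - S r $ j = natural_budget S qbar r"
proof -
  define v :: "outcome \<Rightarrow> belief" where "v \<omega> = (1/2) *\<^sub>R qbar + (1/2) *\<^sub>R axis \<omega> 1" for \<omega>
  \<comment> \<open>Both endpoints halve every coordinate of \<open>qbar\<close> other than
    \<open>k\<close> and \<open>i\<close>, so the whole segment does. Among three outcomes such a
    coordinate always exists, and it is positive at \<open>qbar\<close>; this keeps the segment off
    \<open>qbar\<close>.\<close>
  have segment_coord: "x $ l = qbar $ l / 2"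
    if "x \<in> closed_segment (v k) (v i)" "l \<noteq> k" "l \<noteq> i" for x l k i
    using that by (auto simp: closed_segment_def v_def axis_def field_simps)
  have qbar_not_in: "qbar \<notin> closed_segment (v k) (v i)" for k i
  proof
    assume *: "qbar \<in> closed_segment (v k) (v i)"
    obtain l :: outcome where "l \<noteq> k" "l \<noteq> i"
    proof -
      have "card {k, i} < CARD(outcome)"
        by (rule le_less_trans[OF card_insert_le_m1[of 2]]) auto
      then have "{k, i} \<noteq> UNIV"
        by force
      then show ?thesis
        using that by auto
    qed
    then have "qbar $ l = qbar $ l / 2"
      using segment_coord[OF *] by blast
    moreover have "qbar $ l > 0"
      using qbar by (simp add: positive_beliefs_def)
    ultimately show False
      by simp
  qed
  have v: "v \<omega> \<in> positive_beliefs" "v \<omega> \<noteq> qbar" for \<omega>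
    using midpoint_vertex_in_positive_beliefs[OF qbar] qbar_not_in[of \<omega> \<omega>] by (auto simp: v_def)
  have max_at_v: "\<exists>i. i \<noteq> k \<and> (\<forall>l. S qbar $ l - S (v k) $ l \<le> S qbar $ i - S (v k) $ i)" for k
  proof -
    obtain i where i: "natural_budget S qbar (v k) = S qbar $ i - S (v k) $ i"
      by (rule natural_budget_attained)
    have "0 < natural_budget S qbar (v k)"
      using S qbar v positive_beliefs_subset_simplex by (intro natural_budget_pos) auto
    moreover have "S qbar $ k < S (v k) $ k"
      using score_increases_towards_vertex[OF S qbar v_def] v by blast
    ultimately have "i \<noteq> k"
      using i by auto
    then show ?thesis
      using natural_budget_ge[of S qbar _ "v k"] i by auto
  qed
  \<comment> \<open>The starting vertex 1 is arbitrary. The second endpoint is chosen as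
    \<open>v i\<close> because the loss there is maximal at some \<open>j\<close> different from
    \<open>i\<close>, so the maximal outcome changes along the segment.\<close>
  obtain i where i: "\<And>l. S qbar $ l - S (v 1) $ l \<le> S qbar $ i - S (v 1) $ i"
    using max_at_v[of 1] by blast
  obtain j where j: "j \<noteq> i" "\<And>l. S qbar $ l - S (v i) $ l \<le> S qbar $ j - S (v i) $ j"
    using max_at_v[of i] by blast
  have sub: "closed_segment (v 1) (v i) \<subseteq> positive_beliefs"
    using v convex_positive_beliefs by (intro closed_segment_subset) auto
  then have "continuous_on (closed_segment (v 1) (v i)) (\<lambda>q. S qbar - S q)"
    by (intro continuous_intros continuous_on_subset[OF cont])
  then obtain r m n where r: "r \<in> closed_segment (v 1) (v i)" "m \<noteq> n"
    "\<And>l. (S qbar - S r) $ l \<le> (S qbar - S r) $ m" "\<And>l. (S qbar - S r) $ l \<le> (S qbar - S r) $ n"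
    by (rule connected_maximal_coordinate_tie[OF connected_segment(1) _ ends_in_segment(1) _ 
          ends_in_segment(2), of _ _ _ i j]) (use i j in auto)
  have "S qbar $ m - S r $ m = natural_budget S qbar r"
    "S qbar $ n - S r $ n = natural_budget S qbar r"
    using natural_budget_attained[of S qbar r] natural_budget_ge[of S qbar _ r] r(3,4)
    by (metis order_antisym vector_minus_component)+
  then show ?thesis
    using that r(1,2) sub qbar_not_in by blast
qed

section \<open>Optimality of a report with two binding constraints\<close>

lemma score_less_of_binding_constraints:
  assumes S: "strictly_proper S" and r: "r \<in> positive_beliefs" and q: "q \<in> belief_simplex" "q \<noteq> r"
    and "0 < p $ k" and p: "\<And>\<omega>. \<omega> \<noteq> k \<Longrightarrow> p $ \<omega> * r $ k < p $ k * r $ \<omega>"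
    and binding: "\<And>\<omega>. \<omega> \<noteq> k \<Longrightarrow> S r $ \<omega> \<le> S q $ \<omega>"
  shows "p \<bullet> S q < p \<bullet> S r"
proof -
  \<comment> \<open>With this scaling \<open>t *\<^sub>R r - p\<close> vanishes at \<open>k\<close>,
    where nothing is known about \<open>S q\<close>, and is positive at the other outcomes, where
    \<open>binding\<close> applies.\<close>
  define t where "t = p $ k / r $ k"
  have rk: "r $ k > 0"
    using r by (simp add: positive_beliefs_def)
  then have t: "t > 0"
    using \<open>0 < p $ k\<close> by (simp add: t_def)
  have "r \<bullet> S q < r \<bullet> S r"
    using strictly_proper_less[OF S] r q positive_beliefs_subset_simplex by blast
  then have "(t *\<^sub>R r) \<bullet> (S q - S r) < 0"
    using t by (simp add: inner_diff_right mult_less_0_iff)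
  moreover have "0 \<le> (t *\<^sub>R r - p) \<bullet> (S q - S r)"
  proof -
    have "0 \<le> (t * r $ \<omega> - p $ \<omega>) * (S q $ \<omega> - S r $ \<omega>)" for \<omega>
    proof (cases "\<omega> = k")
      case True
      then show ?thesis using rk by (simp add: t_def)
    next
      case False
      have "p $ \<omega> < t * r $ \<omega>"
        using p[OF False] rk by (simp add: t_def field_simps)
      then show ?thesis
        using binding[OF False] by simp
    qed
    then show ?thesis
      by (simp add: inner_vec_def sum_nonneg)
  qed
  ultimately show ?thesis
    by (simp add: inner_diff_left inner_diff_right)
qed

theorem theorem7:
  fixes S :: scoring_rule and qbar :: belief
  assumes "strictly_proper S"
    and "technical_assumptions S"
    and "qbar \<in> simplex_interior"
  shows "\<exists>(N :: belief set) (b :: real) (r :: belief).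
           N \<noteq> {} \<and> openin (top_of_set belief_plane) N \<and> N \<subseteq> belief_simplex \<and>
           b > 0 \<and>
           r \<in> belief_simplex \<and> natural_budget S qbar r \<le> b \<and>
           (\<forall>p\<in>N. optimal_reports S p qbar b = {r})"
proof -
  have qbar: "qbar \<in> positive_beliefs"
    using assms(3) by (simp add: simplex_interior_eq)
  have "continuous_on positive_beliefs S"
    using assms(2) by (simp add: technical_assumptions_def simplex_interior_eq)
  with assms(1) qbar obtain r i j where r: "r \<in> positive_beliefs" "r \<noteq> qbar" "i \<noteq> j"
    and tie: "S qbar $ i - S r $ i = natural_budget S qbar r"
      "S qbar $ j - S r $ j = natural_budget S qbar r"
    using exists_tie by metis
  \<comment> \<open>This budget makes the constraints for \<open>i\<close> and \<open>j\<close>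
    binding at \<open>r\<close>; it is positive because \<open>r \<noteq> qbar\<close>.\<close>
  define b where "b = natural_budget S qbar r"
  have rs: "r \<in> belief_simplex" and rpos: "\<And>\<omega>. 0 < r $ \<omega>"
    using r positive_beliefs_subset_simplex by (auto simp: positive_beliefs_def)
  have "b > 0"
    unfolding b_def using assms(1) qbar rs r(2) positive_beliefs_subset_simplex
    by (intro natural_budget_pos) auto
  have "\<exists>k. \<forall>\<omega>. \<omega> \<noteq> k \<longrightarrow> \<omega> = i \<or> \<omega> = j"
    using exhaust_3[of i] exhaust_3[of j] \<open>i \<noteq> j\<close> by (auto simp: forall_3)
  then obtain k where k: "\<And>\<omega>. \<omega> \<noteq> k \<Longrightarrow> \<omega> = i \<or> \<omega> = j"
    by blast
  \<comment> \<open>The condition says that the ratio of \<open>p $ \<omega>\<close> to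
    \<open>p $ k\<close> is below that of \<open>r\<close>. It is strict, so \<open>N\<close> is
    open, and cross-multiplied to avoid division. The point halfway from \<open>r\<close> to the
    vertex \<open>k\<close> satisfies it: the other coordinates are halved while coordinate
    \<open>k\<close> becomes \<open>(r $ k + 1) / 2\<close>.\<close>
  define N where "N = positive_beliefs \<inter> {p. \<forall>\<omega>. \<omega> \<noteq> k \<longrightarrow> p $ \<omega> * r $ k < p $ k * r $ \<omega>}"
  have "(1/2) *\<^sub>R r + (1/2) *\<^sub>R axis k 1 \<in> N"
    unfolding N_def using midpoint_vertex_in_positive_beliefs[OF r(1)] rpos
    by (auto simp: axis_def algebra_simps)
  then have "N \<noteq> {}"
    by blast
  moreover have "openin (top_of_set belief_plane) N"
  proof -
    have "open {p :: belief. \<forall>\<omega>. \<omega> \<noteq> k \<longrightarrow> p $ \<omega> * r $ k < p $ k * r $ \<omega>}"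
      by (intro open_Collect_all_finite open_Collect_imp open_Collect_less continuous_intros
          closed_Collect_const)
    then show ?thesis
      unfolding N_def using openin_positive_beliefs openin_Int_open by blast
  qed
  moreover have "N \<subseteq> belief_simplex"
    using positive_beliefs_subset_simplex by (auto simp: N_def)
  moreover have "optimal_reports S p qbar b = {r}" if "p \<in> N" for p
  proof -
    have feasible: "r \<in> feasible_reports S qbar b"
      using rs by (simp add: feasible_reports_def b_def)
    have less: "p \<bullet> S q < p \<bullet> S r" if q: "q \<in> feasible_reports S qbar b" "q \<noteq> r" for q
    proof (rule score_less_of_binding_constraints[OF assms(1) r(1) _ q(2), of p k])
      show "q \<in> belief_simplex"
        using q by (simp add: feasible_reports_def)
      show "0 < p $ k"
        using \<open>p \<in> N\<close> by (simp add: N_def positive_beliefs_def)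
      show "p $ \<omega> * r $ k < p $ k * r $ \<omega>" if "\<omega> \<noteq> k" for \<omega>
        using \<open>p \<in> N\<close> that by (auto simp: N_def)
      show "S r $ \<omega> \<le> S q $ \<omega>" if "\<omega> \<noteq> k" for \<omega>
      proof -
        have "S qbar $ \<omega> - S q $ \<omega> \<le> b"
          using natural_budget_ge[of S qbar \<omega> q] q by (simp add: feasible_reports_def)
        moreover have "S qbar $ \<omega> - S r $ \<omega> = b"
          using k[OF that] tie by (auto simp: b_def)
        ultimately show ?thesis
          by simp
      qed
    qed
    then show ?thesis
      using feasible
      by (auto simp: optimal_reports_def maximizers_def is_arg_max_def expected_score_def)
        (metis less less_asym)+
  qed
  ultimately show ?thesis
    using \<open>b > 0\<close> rs b_def by blast
qed

end
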